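(* Let $\mathbb{C}_n$ be a Clifford algebra over the field $\mathbb{F}=\mathbb{C}$ and let $\mathrm{Ext}(\mathbb{C}_n)=\{\mathrm{Id},\star,\widetilde{\phantom{cc}},\widetilde{\star},\overline{\phantom{cc}},\overline{\star},\overline{\widetilde{\phantom{cc}}},\overline{\widetilde{\star}}\}$ be the extended automorphism group of the algebra $\mathbb{C}_n$. Then there is an isomorphism between $\mathrm{Ext}(\mathbb{C}_n)$ and the full $CPT$-group of the discrete transformations, $$\mathrm{Ext}(\mathbb{C}_n)\simeq\{1,P,T,PT,C,CP,CT,CPT\}\simeq\mathbb{Z}_2\otimes\mathbb{Z}_2\otimes\mathbb{Z}_2 .$$ In this case space inversion $P$, time reversal $T$, full reflection $PT$, charge conjugation $C$, the transformations $CP$, $CT$ and the full $CPT$-transformation correspond respectively to the automorphism $\mathcal{A}\rightarrow\mathcal{A}^\star$, the antiautomorphisms $\mathcal{A}\rightarrow\widetilde{\mathcal{A}}$, $\mathcal{A}\rightarrow\widetilde{\mathcal{A}^\star}$, the pseudoautomorphisms $\mathcal{A}\rightarrow\overline{\mathcal{A}}$, $\mathcal{A}\rightarrow\overline{\mathcal{A}^\star}$, and the pseudoantiautomorphisms $\mathcal{A}\rightarrow\overline{\widetilde{\mathcal{A}}}$ and $\mathcal{A}\rightarrow\overline{\widetilde{\mathcal{A}^\star}}$.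
   Context: $\mathbb{C}_n$ is the complex Clifford algebra of $\mathbb{C}^n$. Fix $n=p+q$ and the real subalgebra $C\ell_{p,q}\subset\mathbb{C}_n$ (generated by $\mathbf{e}_1,\dots,\mathbf{e}_p,i\mathbf{e}_{p+1},\dots,i\mathbf{e}_{p+q}$, where $\mathbf{e}_1,\dots,\mathbf{e}_n$ is an orthobasis with $\mathbf{e}_i^2=1$), so that each $\mathcal{A}\in\mathbb{C}_n$ is uniquely $\mathcal{A}_1+i\mathcal{A}_2$ with $\mathcal{A}_1,\mathcal{A}_2\in C\ell_{p,q}$. Transformations of $\mathbb{C}_n$: the involution $\mathcal{A}\to\mathcal{A}^\star$ is the algebra automorphism with $\mathbf{e}_i\to-\mathbf{e}_i$; the reversion $\mathcal{A}\to\widetilde{\mathcal{A}}$ is the antiautomorphism with $\mathbf{e}_i\to\mathbf{e}_i$; the conjugation $\mathcal{A}\to\widetilde{\mathcal{A}^\star}$ is their composition; the pseudoautomorphism $\mathcal{A}\to\overline{\mathcal{A}}$ is $\mathcal{A}_1+i\mathcal{A}_2\mapsto\mathcal{A}_1-i\mathcal{A}_2$; $\overline{\star}$, $\overline{\widetilde{\phantom{cc}}}$, $\overline{\widetilde{\star}}$ are the compositions of $\overline{\phantom{cc}}$ with $\star$, $\widetilde{\phantom{cc}}$, $\widetilde{\star}$ respectively. The group operation on $\mathrm{Ext}(\mathbb{C}_n)$ is composition. The $CPT$-group here is the group of order 8 generated by commuting elements $P,T,C$ with $P^2=T^2=(PT)^2=C^2=(CP)^2=(CT)^2=(CPT)^2=1$.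 The symbol $\otimes$ between groups denotes direct product.
   Formalization: The formal theorem assumes n = p + q ≥ 2; for n = 1 the reversion is the identity, so Ext has only 4 elements, and for n = 0 only 2, so the claimed isomorphism fails there. *)

theory Defs
  imports "HOL-Algebra.Algebra" Complex_Main
begin

text \<open>
  A multivector is its family of coefficients: x S is the coefficient of the product
  of the e_i with i in S, taken in increasing order of the indices.  Bringing the
  concatenation of two such products into increasing order moves every e_b to the left of
  each e_a with b < a, at the cost of a factor -1 each; equal factors then cancel
  since e_i^2 = 1.
\<close>

definition blade :: "nat set \<Rightarrow> nat set \<Rightarrow> complex" where
  "blade S = (\<lambda>T. if T = S then 1 else 0)"

definition reorder_sign :: "nat set \<Rightarrow> nat set \<Rightarrow> complex" where
  "reorder_sign S T = (\<Prod>a\<in>S. \<Prod>b\<in>T. if b < a then -1 else 1)"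

definition clifford :: "nat \<Rightarrow> (complex, nat set \<Rightarrow> complex) module" where
  "clifford n = \<lparr>
     carrier = {x. \<forall>S. \<not> S \<subseteq> {1..n} \<longrightarrow> x S = 0},
     monoid.mult = (\<lambda>x y U. \<Sum>S\<in>Pow {1..n}. \<Sum>T\<in>Pow {1..n}.
               if sym_diff S T = U then reorder_sign S T * x S * y T else 0),
     one = blade {},
     ring.zero = (\<lambda>S. 0),
     ring.add = (\<lambda>x y S. x S + y S),
     module.smult = (\<lambda>c x S. c * x S)\<rparr>"

definition gen :: "nat \<Rightarrow> nat set \<Rightarrow> complex" where
  "gen i = blade {i}"

lemma prod_sym_diff:
  fixes f :: "nat \<Rightarrow> complex"
  assumes "finite S" "finite T" "\<And>i. f i * f i = 1"
  shows "prod f (sym_diff S T) = prod f S * prod f T"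
proof -
  have S: "prod f S = prod f (S - T) * prod f (S \<inter> T)"
    using assms by (metis Diff_Diff_Int Diff_subset mult.commute prod.subset_diff)
  have T: "prod f T = prod f (T - S) * prod f (S \<inter> T)"
    using assms by (metis Diff_Diff_Int Diff_subset Int_commute mult.commute prod.subset_diff)
  have sq: "prod f (S \<inter> T) * prod f (S \<inter> T) = 1"
    using assms by (simp flip: prod.distrib)
  have "prod f (sym_diff S T) = prod f (S - T) * prod f (T - S)"
    by (rule prod.union_disjoint) (use assms in auto)
  also have "\<dots> = prod f S * prod f T"
    unfolding S T using sq by (metis (no_types, opaque_lifting) mult.assoc mult.commute mult.left_neutral)
  finally show ?thesis .
qed

lemma reorder_sign_sym_diff_left:
  assumes "finite S" "finite T"
  shows "reorder_sign (sym_diff S T) U = reorder_sign S U * reorder_sign T U"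
  unfolding reorder_sign_def
  by (rule prod_sym_diff) (use assms in \<open>auto simp flip: prod.distrib intro!: prod.neutral\<close>)

lemma reorder_sign_sym_diff_right:
  assumes "finite S" "finite T"
  shows "reorder_sign U (sym_diff S T) = reorder_sign U S * reorder_sign U T"
proof -
  have "reorder_sign U (sym_diff S T) =
      (\<Prod>a\<in>U. (\<Prod>b\<in>S. if b < a then -1 else 1) * (\<Prod>b\<in>T. if b < a then -1 else 1))"
    unfolding reorder_sign_def
    by (intro prod.cong refl prod_sym_diff) (use assms in auto)
  then show ?thesis
    by (simp add: reorder_sign_def prod.distrib)
qed

lemma clifford_mult_apply:
  "(x \<otimes>\<^bsub>clifford n\<^esub> y) U = (\<Sum>S\<in>Pow {1..n}. \<Sum>T\<in>Pow {1..n}.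
     if sym_diff S T = U then reorder_sign S T * x S * y T else 0)"
  by (simp add: clifford_def)

lemma clifford_mult_blade:
  assumes "S \<subseteq> {1..n}" "T \<subseteq> {1..n}"
  shows "blade S \<otimes>\<^bsub>clifford n\<^esub> blade T =
    reorder_sign S T \<odot>\<^bsub>clifford n\<^esub> blade (sym_diff S T)"
proof
  fix U
  have "(blade S \<otimes>\<^bsub>clifford n\<^esub> blade T) U =
      (\<Sum>S'\<in>Pow {1..n}. if S' = S then
        (\<Sum>T'\<in>Pow {1..n}. if T' = T then
          (if sym_diff S T = U then reorder_sign S T else 0) else 0) else 0)"
    unfolding clifford_mult_apply
  proof (intro sum.cong refl)
    fix S'
    show "(\<Sum>T'\<in>Pow {1..n}. if sym_diff S' T' = U then
          reorder_sign S' T' * blade S S' * blade T T' else 0) =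
        (if S' = S then (\<Sum>T'\<in>Pow {1..n}. if T' = T then
          (if sym_diff S T = U then reorder_sign S T else 0) else 0) else 0)"
    proof (cases "S' = S")
      case True
      show ?thesis
        unfolding True if_P[OF refl] by (intro sum.cong refl) (simp add: blade_def)
    qed (simp add: blade_def cong: if_cong)
  qed
  also have "\<dots> = (reorder_sign S T \<odot>\<^bsub>clifford n\<^esub> blade (sym_diff S T)) U"
    using assms by (auto simp: sum.delta clifford_def blade_def)
  finally show "(blade S \<otimes>\<^bsub>clifford n\<^esub> blade T) U =
    (reorder_sign S T \<odot>\<^bsub>clifford n\<^esub> blade (sym_diff S T)) U" .
qed

lemma clifford_gen_square:
  assumes "i \<in> {1..n}"
  shows "gen i \<otimes>\<^bsub>clifford n\<^esub> gen i = \<one>\<^bsub>clifford n\<^esub>"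
  using assms
  by (simp add: gen_def clifford_mult_blade) (simp add: clifford_def reorder_sign_def)

lemma clifford_gen_anticommute:
  assumes "i \<in> {1..n}" "j \<in> {1..n}" "i \<noteq> j"
  shows "gen i \<otimes>\<^bsub>clifford n\<^esub> gen j = (-1) \<odot>\<^bsub>clifford n\<^esub> (gen j \<otimes>\<^bsub>clifford n\<^esub> gen i)"
proof -
  have "sym_diff {i} {j} = sym_diff {j} {i}" by auto
  with assms show ?thesis
    by (simp add: gen_def clifford_mult_blade) (auto simp: clifford_def reorder_sign_def)
qed

lemma clifford_blade_insert:
  assumes "i \<in> {1..n}" "S \<subseteq> {1..n}" "\<forall>j\<in>S. i < j"
  shows "blade (insert i S) = gen i \<otimes>\<^bsub>clifford n\<^esub> blade S"
proof -
  have "sym_diff {i} S = insert i S" using assms(3) by auto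
  moreover have "reorder_sign {i} S = 1"
    using assms(3) by (auto simp: reorder_sign_def intro!: prod.neutral)
  ultimately show ?thesis
    using assms by (simp add: gen_def clifford_mult_blade) (simp add: clifford_def)
qed

lemma clifford_assoc:
  "(x \<otimes>\<^bsub>clifford n\<^esub> y) \<otimes>\<^bsub>clifford n\<^esub> z = x \<otimes>\<^bsub>clifford n\<^esub> (y \<otimes>\<^bsub>clifford n\<^esub> z)"
proof
  fix V
  let ?P = "Pow {1..n}"
  have fin: "finite S" if "S \<in> ?P" for S using that finite_subset by blast
  have distrib: "(if Q then c * (\<Sum>S\<in>A. \<Sum>T\<in>B. if g S T = W then f S T else 0) * d else 0) =
      (\<Sum>S\<in>A. \<Sum>T\<in>B. if W = g S T then (if Q then c * f S T * d else 0) else 0)"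
    for Q c d A B and g :: "nat set \<Rightarrow> nat set \<Rightarrow> nat set" and W and f :: "_ \<Rightarrow> _ \<Rightarrow> complex"
  proof (cases Q)
    case True
    show ?thesis
      unfolding if_P[OF True] sum_distrib_left sum_distrib_right
      by (intro sum.cong refl) auto
  qed (simp cong: if_cong)
  have pw: "sym_diff S T \<in> ?P" if "S \<in> ?P" "T \<in> ?P" for S T using that by auto
  have assoc: "sym_diff (sym_diff S T) U = sym_diff S (sym_diff T U)" for S T U :: "nat set"
    by auto
  have "((x \<otimes>\<^bsub>clifford n\<^esub> y) \<otimes>\<^bsub>clifford n\<^esub> z) V =
      (\<Sum>W\<in>?P. \<Sum>U\<in>?P. if sym_diff W U = V then reorder_sign W U *
        (\<Sum>S\<in>?P. \<Sum>T\<in>?P. if sym_diff S T = W then reorder_sign S T * x S * y T else 0) * z U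
        else 0)"
    by (simp only: clifford_mult_apply)
  also have "\<dots> = (\<Sum>W\<in>?P. \<Sum>U\<in>?P. \<Sum>S\<in>?P. \<Sum>T\<in>?P. if W = sym_diff S T then
      (if sym_diff W U = V then reorder_sign W U * (reorder_sign S T * x S * y T) * z U else 0)
      else 0)"
    by (intro sum.cong refl distrib)
  also have "\<dots> = (\<Sum>U\<in>?P. \<Sum>S\<in>?P. \<Sum>W\<in>?P. \<Sum>T\<in>?P. if W = sym_diff S T then
      (if sym_diff W U = V then reorder_sign W U * (reorder_sign S T * x S * y T) * z U else 0)
      else 0)"
    by (rule trans[OF sum.swap], rule sum.cong[OF refl], rule sum.swap)
  also have "\<dots> = (\<Sum>U\<in>?P. \<Sum>S\<in>?P. \<Sum>T\<in>?P. \<Sum>W\<in>?P. if W = sym_diff S T then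
      (if sym_diff W U = V then reorder_sign W U * (reorder_sign S T * x S * y T) * z U else 0)
      else 0)"
    by (rule sum.cong[OF refl], rule sum.cong[OF refl], rule sum.swap)
  also have "\<dots> = (\<Sum>U\<in>?P. \<Sum>S\<in>?P. \<Sum>T\<in>?P.
      if sym_diff (sym_diff S T) U = V then
        reorder_sign (sym_diff S T) U * (reorder_sign S T * x S * y T) * z U else 0)"
    using pw by (intro sum.cong refl) (subst sum.delta, auto)
  also have "\<dots> = (\<Sum>S\<in>?P. \<Sum>U\<in>?P. \<Sum>T\<in>?P.
      if sym_diff (sym_diff S T) U = V then
        reorder_sign (sym_diff S T) U * (reorder_sign S T * x S * y T) * z U else 0)"
    by (rule sum.swap)
  also have "\<dots> = (\<Sum>S\<in>?P. \<Sum>U\<in>?P. \<Sum>T\<in>?P.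
      if sym_diff S (sym_diff T U) = V then
        reorder_sign S (sym_diff T U) * x S * (reorder_sign T U * y T * z U) else 0)"
    by (intro sum.cong refl)
      (simp add: assoc reorder_sign_sym_diff_left reorder_sign_sym_diff_right fin mult_ac)
  also have "\<dots> = (\<Sum>S\<in>?P. \<Sum>T\<in>?P. \<Sum>U\<in>?P.
      if sym_diff S (sym_diff T U) = V then
        reorder_sign S (sym_diff T U) * x S * (reorder_sign T U * y T * z U) else 0)"
    by (rule sum.cong[OF refl], rule sum.swap)
  also have "\<dots> = (\<Sum>S\<in>?P. \<Sum>T\<in>?P. \<Sum>U\<in>?P. \<Sum>W\<in>?P. if W = sym_diff T U then
      (if sym_diff S W = V then
        reorder_sign S W * x S * (reorder_sign T U * y T * z U) else 0) else 0)"
    using pw by (intro sum.cong refl) (subst sum.delta, auto)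
  also have "\<dots> = (\<Sum>S\<in>?P. \<Sum>T\<in>?P. \<Sum>W\<in>?P. \<Sum>U\<in>?P. if W = sym_diff T U then
      (if sym_diff S W = V then
        reorder_sign S W * x S * (reorder_sign T U * y T * z U) else 0) else 0)"
    by (rule sum.cong[OF refl], rule sum.cong[OF refl], rule sum.swap)
  also have "\<dots> = (\<Sum>S\<in>?P. \<Sum>W\<in>?P. \<Sum>T\<in>?P. \<Sum>U\<in>?P. if W = sym_diff T U then
      (if sym_diff S W = V then
        reorder_sign S W * x S * (reorder_sign T U * y T * z U) else 0) else 0)"
    by (rule sum.cong[OF refl], rule sum.swap)
  also have "\<dots> = (\<Sum>S\<in>?P. \<Sum>W\<in>?P. if sym_diff S W = V then reorder_sign S W * x S *
      (\<Sum>T\<in>?P. \<Sum>U\<in>?P. if sym_diff T U = W then reorder_sign T U * y T * z U else 0)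
      else 0)"
    by (intro sum.cong refl) (simp only: distrib[where d = 1, unfolded mult_1_right])
  also have "\<dots> = (x \<otimes>\<^bsub>clifford n\<^esub> (y \<otimes>\<^bsub>clifford n\<^esub> z)) V"
    by (simp only: clifford_mult_apply)
  finally show "((x \<otimes>\<^bsub>clifford n\<^esub> y) \<otimes>\<^bsub>clifford n\<^esub> z) V = (x \<otimes>\<^bsub>clifford n\<^esub> (y \<otimes>\<^bsub>clifford n\<^esub> z)) V" .
qed

lemma clifford_mult_closed:
  "x \<otimes>\<^bsub>clifford n\<^esub> y \<in> carrier (clifford n)"
proof -
  have "(x \<otimes>\<^bsub>clifford n\<^esub> y) U = 0" if U: "\<not> U \<subseteq> {1..n}" for U
    unfolding clifford_mult_apply
  proof (intro sum.neutral ballI)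
    fix S T assume "S \<in> Pow {1..n}" "T \<in> Pow {1..n}"
    then have "sym_diff S T \<subseteq> {1..n}" by blast
    with U show "(if sym_diff S T = U then reorder_sign S T * x S * y T else 0) = 0" by metis
  qed
  then show ?thesis by (simp add: clifford_def)
qed

lemma clifford_one_mult:
  assumes "x \<in> carrier (clifford n)"
  shows "\<one>\<^bsub>clifford n\<^esub> \<otimes>\<^bsub>clifford n\<^esub> x = x"
proof
  fix U
  have one: "\<one>\<^bsub>clifford n\<^esub> = blade {}" by (simp add: clifford_def)
  have "(\<one>\<^bsub>clifford n\<^esub> \<otimes>\<^bsub>clifford n\<^esub> x) U =
      (\<Sum>S\<in>Pow {1..n}. if S = {} then (\<Sum>T\<in>Pow {1..n}. if T = U then x T else 0) else 0)"
    unfolding clifford_mult_apply one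
  proof (intro sum.cong refl)
    fix S
    show "(\<Sum>T\<in>Pow {1..n}. if sym_diff S T = U then reorder_sign S T * blade {} S * x T else 0) =
        (if S = {} then (\<Sum>T\<in>Pow {1..n}. if T = U then x T else 0) else 0)"
      by (cases "S = {}") (simp_all add: blade_def reorder_sign_def cong: if_cong)
  qed
  also have "\<dots> = x U"
    using assms by (auto simp: sum.delta clifford_def)
  finally show "(\<one>\<^bsub>clifford n\<^esub> \<otimes>\<^bsub>clifford n\<^esub> x) U = x U" .
qed

lemma clifford_mult_one:
  assumes "x \<in> carrier (clifford n)"
  shows "x \<otimes>\<^bsub>clifford n\<^esub> \<one>\<^bsub>clifford n\<^esub> = x"
proof
  fix U
  have one: "\<one>\<^bsub>clifford n\<^esub> = blade {}" by (simp add: clifford_def)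
  have "(x \<otimes>\<^bsub>clifford n\<^esub> \<one>\<^bsub>clifford n\<^esub>) U =
      (\<Sum>S\<in>Pow {1..n}. \<Sum>T\<in>Pow {1..n}. if T = {} then (if S = U then x S else 0) else 0)"
    unfolding clifford_mult_apply one
  proof (intro sum.cong refl)
    fix S T
    show "(if sym_diff S T = U then reorder_sign S T * x S * blade {} T else 0) =
        (if T = {} then (if S = U then x S else 0) else 0)"
      by (cases "T = {}") (simp_all add: blade_def reorder_sign_def)
  qed
  also have "\<dots> = (\<Sum>S\<in>Pow {1..n}. if S = U then x S else 0)"
    by (intro sum.cong refl) (simp add: sum.delta)
  also have "\<dots> = x U"
    using assms by (auto simp: sum.delta clifford_def)
  finally show "(x \<otimes>\<^bsub>clifford n\<^esub> \<one>\<^bsub>clifford n\<^esub>) U = x U" .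
qed

lemma clifford_ring: "ring (clifford n)"
proof (rule ringI)
  show "abelian_group (clifford n)"
  proof (rule abelian_groupI)
    fix x assume "x \<in> carrier (clifford n)"
    then show "\<exists>y\<in>carrier (clifford n). y \<oplus>\<^bsub>clifford n\<^esub> x = \<zero>\<^bsub>clifford n\<^esub>"
      by (intro bexI[of _ "\<lambda>S. - x S"]) (auto simp: clifford_def)
  qed (auto simp: clifford_def add_ac)
  show "monoid (clifford n)"
  proof (rule monoidI)
    show "\<one>\<^bsub>clifford n\<^esub> \<in> carrier (clifford n)"
      by (auto simp: clifford_def blade_def)
  qed (simp_all add: clifford_mult_closed clifford_assoc clifford_one_mult clifford_mult_one)
  fix x y z
  show "(x \<oplus>\<^bsub>clifford n\<^esub> y) \<otimes>\<^bsub>clifford n\<^esub> z =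
      x \<otimes>\<^bsub>clifford n\<^esub> z \<oplus>\<^bsub>clifford n\<^esub> y \<otimes>\<^bsub>clifford n\<^esub> z"
    by (auto simp: clifford_def algebra_simps fun_eq_iff simp flip: sum.distrib intro!: sum.cong)
  show "z \<otimes>\<^bsub>clifford n\<^esub> (x \<oplus>\<^bsub>clifford n\<^esub> y) =
      z \<otimes>\<^bsub>clifford n\<^esub> x \<oplus>\<^bsub>clifford n\<^esub> z \<otimes>\<^bsub>clifford n\<^esub> y"
    by (auto simp: clifford_def algebra_simps fun_eq_iff simp flip: sum.distrib intro!: sum.cong)
qed

text \<open>The generators e_1, ..., e_p, i e_{p+1}, ..., i e_{p+q} square to 1 (p times)
  and to -1 (q times).\<close>

inductive_set real_clifford :: "nat \<Rightarrow> nat \<Rightarrow> (nat set \<Rightarrow> complex) set" for p q where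
  one: "\<one>\<^bsub>clifford (p + q)\<^esub> \<in> real_clifford p q"
| gen_pos: "i \<in> {1..p} \<Longrightarrow> gen i \<in> real_clifford p q"
| gen_neg: "i \<in> {p+1..p+q} \<Longrightarrow> \<i> \<odot>\<^bsub>clifford (p + q)\<^esub> gen i \<in> real_clifford p q"
| smult: "x \<in> real_clifford p q \<Longrightarrow>
    complex_of_real r \<odot>\<^bsub>clifford (p + q)\<^esub> x \<in> real_clifford p q"
| add: "x \<in> real_clifford p q \<Longrightarrow> y \<in> real_clifford p q \<Longrightarrow>
    x \<oplus>\<^bsub>clifford (p + q)\<^esub> y \<in> real_clifford p q"
| mult: "x \<in> real_clifford p q \<Longrightarrow> y \<in> real_clifford p q \<Longrightarrow>
    x \<otimes>\<^bsub>clifford (p + q)\<^esub> y \<in> real_clifford p q"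

text \<open>
  As in the library's Bij, maps of the carrier are taken extensional,
  so that they are determined by their values on the algebra.
\<close>

definition opposite :: "('a, 'm) ring_scheme \<Rightarrow> ('a, 'm) ring_scheme" where
  "opposite R = R\<lparr>monoid.mult := (\<lambda>x y. y \<otimes>\<^bsub>R\<^esub> x)\<rparr>"

text \<open>For s = id: the linear maps; for s = cnj: the antilinear ones.\<close>

definition semilinear_maps ::
  "(complex \<Rightarrow> complex) \<Rightarrow> (complex, 'a, 'm) module_scheme \<Rightarrow> ('a \<Rightarrow> 'a) set" where
  "semilinear_maps s A = {f \<in> extensional (carrier A).
     \<forall>c. \<forall>x\<in>carrier A. f (c \<odot>\<^bsub>A\<^esub> x) = s c \<odot>\<^bsub>A\<^esub> f x}"

definition automorphisms where
  "automorphisms A = ring_iso A A \<inter> semilinear_maps id A"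

definition antiautomorphisms where
  "antiautomorphisms A = ring_iso A (opposite A) \<inter> semilinear_maps id A"

definition pseudoautomorphisms where
  "pseudoautomorphisms A = ring_iso A A \<inter> semilinear_maps cnj A"

definition pseudoantiautomorphisms where
  "pseudoantiautomorphisms A = ring_iso A (opposite A) \<inter> semilinear_maps cnj A"

definition involution :: "nat \<Rightarrow> (nat set \<Rightarrow> complex) \<Rightarrow> (nat set \<Rightarrow> complex)" where
  "involution n = (THE f. f \<in> automorphisms (clifford n) \<and>
     (\<forall>i\<in>{1..n}. f (gen i) = \<ominus>\<^bsub>clifford n\<^esub> gen i))"

definition reversion :: "nat \<Rightarrow> (nat set \<Rightarrow> complex) \<Rightarrow> (nat set \<Rightarrow> complex)" where
  "reversion n = (THE f. f \<in> antiautomorphisms (clifford n) \<and>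
     (\<forall>i\<in>{1..n}. f (gen i) = gen i))"

definition conjugation :: "nat \<Rightarrow> (nat set \<Rightarrow> complex) \<Rightarrow> (nat set \<Rightarrow> complex)" where
  "conjugation n = compose (carrier (clifford n)) (reversion n) (involution n)"

definition bar :: "nat \<Rightarrow> nat \<Rightarrow> (nat set \<Rightarrow> complex) \<Rightarrow> (nat set \<Rightarrow> complex)" where
  "bar p q = (\<lambda>x\<in>carrier (clifford (p + q)). THE y.
     \<exists>x1\<in>real_clifford p q. \<exists>x2\<in>real_clifford p q.
       x = x1 \<oplus>\<^bsub>clifford (p + q)\<^esub> (\<i> \<odot>\<^bsub>clifford (p + q)\<^esub> x2) \<and>
       y = x1 \<ominus>\<^bsub>clifford (p + q)\<^esub> (\<i> \<odot>\<^bsub>clifford (p + q)\<^esub> x2))"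

definition bar_involution :: "nat \<Rightarrow> nat \<Rightarrow> (nat set \<Rightarrow> complex) \<Rightarrow> (nat set \<Rightarrow> complex)" where
  "bar_involution p q =
     compose (carrier (clifford (p + q))) (bar p q) (involution (p + q))"

definition bar_reversion :: "nat \<Rightarrow> nat \<Rightarrow> (nat set \<Rightarrow> complex) \<Rightarrow> (nat set \<Rightarrow> complex)" where
  "bar_reversion p q =
     compose (carrier (clifford (p + q))) (bar p q) (reversion (p + q))"

definition bar_conjugation :: "nat \<Rightarrow> nat \<Rightarrow> (nat set \<Rightarrow> complex) \<Rightarrow> (nat set \<Rightarrow> complex)" where
  "bar_conjugation p q =
     compose (carrier (clifford (p + q))) (bar p q) (conjugation (p + q))"

text \<open>
  The eight maps below are pairwise distinct only for p + q at least 2: for p + q = 1 the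
  algebra is commutative and the reversion is the identity, for p + q = 0 the involution is
  the identity as well.
\<close>

definition Ext ::
  "nat \<Rightarrow> nat \<Rightarrow> ((nat set \<Rightarrow> complex) \<Rightarrow> (nat set \<Rightarrow> complex)) monoid" where
  "Ext p q = BijGroup (carrier (clifford (p + q)))\<lparr>carrier :=
     {\<lambda>x\<in>carrier (clifford (p + q)). x, involution (p + q), reversion (p + q),
      conjugation (p + q), bar p q, bar_involution p q, bar_reversion p q,
      bar_conjugation p q}\<rparr>"

locale CPT_group = group G for G (structure) +
  fixes P T C
  assumes in_carrier: "P \<in> carrier G" "T \<in> carrier G" "C \<in> carrier G"
    and order_8: "order G = 8"
    and generated: "carrier G = generate G {P, T, C}"
    and commuting: "P \<otimes> T = T \<otimes> P" "C \<otimes> P = P \<otimes> C" "C \<otimes> T = T \<otimes> C"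
    and squares: "P [^] (2::nat) = \<one>" "T [^] (2::nat) = \<one>" "(P \<otimes> T) [^] (2::nat) = \<one>"
      "C [^] (2::nat) = \<one>" "(C \<otimes> P) [^] (2::nat) = \<one>" "(C \<otimes> T) [^] (2::nat) = \<one>"
      "(C \<otimes> P \<otimes> T) [^] (2::nat) = \<one>"

end

theory Submission
  imports Defs
begin

text \<open>
  In the basis of the blades each of the eight maps is diagonal up to complex conjugation: it
  sends the coefficient at S to s(S) times itself or its conjugate, for a sign s(S).  The signs are
  (-1)^|S| for the involution, the sign of reversing the order of the elements of S for the
  reversion, and (-1)^k with k the number of elements of S above p for the bar; the other maps have
  the products of these.  Hence the involution, the reversion and the bar are commuting involutions.
  No nontrivial product of them is the identity: those containing the bar are antilinear, and the
  three others move e_1 or e_1 e_2.  So they generate a copy of the elementary abelian group of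
  order 8, as do P, T and C.
\<close>

section \<open>Groups generated by three commuting involutions\<close>

abbreviation (input) klein3 :: "(int \<times> int \<times> int) monoid" where
  "klein3 \<equiv> integer_mod_group 2 \<times>\<times> integer_mod_group 2 \<times>\<times> integer_mod_group 2"

lemma group_klein3: "group klein3"
  by (intro DirProd_group group_integer_mod_group)

lemma carrier_klein3: "carrier klein3 = {0, 1} \<times> {0, 1} \<times> {0, 1}"
proof -
  have "{0..<2::int} = {0, 1}" by auto
  then show ?thesis by (simp add: carrier_integer_mod_group)
qed

text \<open>A triple lists the exponents of \<open>P\<close>, \<open>T\<close> and \<open>C\<close>
  in this order, while the word itself is written in the normal form C (P T). Exponents modulo 2
  suffice because the three elements are involutions in every application.\<close>

definition cpt_word ::
  "('a, 'm) monoid_scheme \<Rightarrow> 'a \<Rightarrow> 'a \<Rightarrow> 'a \<Rightarrow> int \<times> int \<times> int \<Rightarrow> 'a" where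
  "cpt_word G P T C = (\<lambda>(a, b, c).
     (if c = 0 then \<one>\<^bsub>G\<^esub> else C) \<otimes>\<^bsub>G\<^esub>
     ((if a = 0 then \<one>\<^bsub>G\<^esub> else P) \<otimes>\<^bsub>G\<^esub> (if b = 0 then \<one>\<^bsub>G\<^esub> else T)))"

text \<open>Neither order nor generation is assumed, so the locale covers \<open>G\<close>,
  \<open>Ext p q\<close> and the full group of bijections of the algebra. The equations in
  \<open>comm\<close> are oriented so that rewriting sorts every word into the order C, P,
  T.\<close>

locale commuting_involutions = group G for G (structure) +
  fixes P T C
  assumes closed [simp]: "P \<in> carrier G" "T \<in> carrier G" "C \<in> carrier G"
    and comm: "T \<otimes> P = P \<otimes> T" "P \<otimes> C = C \<otimes> P" "T \<otimes> C = C \<otimes> T"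
    and square: "P \<otimes> P = \<one>" "T \<otimes> T = \<one>" "C \<otimes> C = \<one>"
begin

lemma left_comm:
  assumes "x \<in> carrier G"
  shows "T \<otimes> (P \<otimes> x) = P \<otimes> (T \<otimes> x)" "P \<otimes> (C \<otimes> x) = C \<otimes> (P \<otimes> x)" "T \<otimes> (C \<otimes> x) = C \<otimes> (T \<otimes> x)"
  using assms by (simp_all add: comm flip: m_assoc)

lemma left_square:
  assumes "x \<in> carrier G"
  shows "P \<otimes> (P \<otimes> x) = x" "T \<otimes> (T \<otimes> x) = x" "C \<otimes> (C \<otimes> x) = x"
  using assms by (simp_all add: square flip: m_assoc)

lemmas normalize = m_assoc comm square left_comm left_square

text \<open>The carrier is finite, so this is a check over all pairs of triples:
  \<open>normalize\<close> brings both sides to the same sorted word.\<close>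

lemma cpt_word_hom: "cpt_word G P T C \<in> hom klein3 G"
proof (rule homI)
  fix x y assume "x \<in> carrier klein3" "y \<in> carrier klein3"
  then show "cpt_word G P T C (x \<otimes>\<^bsub>klein3\<^esub> y) = cpt_word G P T C x \<otimes> cpt_word G P T C y"
    unfolding carrier_klein3 by (auto simp: cpt_word_def normalize)
qed (auto simp: cpt_word_def)

lemma cpt_word_image:
  "cpt_word G P T C ` carrier klein3 =
     {\<one>, P, T, P \<otimes> T, C, C \<otimes> P, C \<otimes> T, C \<otimes> P \<otimes> T}"
  unfolding carrier_klein3 by (auto simp: cpt_word_def m_assoc image_iff)

text \<open>The image of the homomorphism \<open>cpt_word\<close> is a subgroup containing the three
  generators, so it contains all that they generate; conversely each of its eight words is a product
  of generators.\<close>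

lemma generate_eq:
  "generate G {P, T, C} = {\<one>, P, T, P \<otimes> T, C, C \<otimes> P, C \<otimes> T, C \<otimes> P \<otimes> T}"
proof -
  interpret hom: group_hom klein3 G "cpt_word G P T C"
    by (intro group_hom.intro group_hom_axioms.intro group_klein3 group_axioms cpt_word_hom)
  have "generate G {P, T, C} \<subseteq> cpt_word G P T C ` carrier klein3"
    using hom.img_is_subgroup by (rule generate_subgroup_incl[rotated]) (subst cpt_word_image, simp)
  moreover have "{P, T, C} \<subseteq> generate G {P, T, C}"
    by (auto intro: generate.incl)
  then have "{\<one>, P, T, P \<otimes> T, C, C \<otimes> P, C \<otimes> T, C \<otimes> P \<otimes> T} \<subseteq> generate G {P, T, C}"
    by (auto intro!: generate.one generate.eng)
  ultimately show ?thesis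
    unfolding cpt_word_image by blast
qed

lemma cpt_word_iso:
  assumes "carrier G = {\<one>, P, T, P \<otimes> T, C, C \<otimes> P, C \<otimes> T, C \<otimes> P \<otimes> T}"
    and "inj_on (cpt_word G P T C) (carrier klein3)"
  shows "cpt_word G P T C \<in> iso klein3 G"
  using assms cpt_word_hom cpt_word_image unfolding iso_def bij_betw_def by blast

text \<open>A surjection between two sets of 8 elements is injective. This is the criterion used for
  the abstract group \<open>G\<close>, whose order is given.\<close>

lemma cpt_word_inj_of_order:
  assumes "carrier G = {\<one>, P, T, P \<otimes> T, C, C \<otimes> P, C \<otimes> T, C \<otimes> P \<otimes> T}" and "order G = 8"
  shows "inj_on (cpt_word G P T C) (carrier klein3)"
proof (rule eq_card_imp_inj_on)
  show "finite (carrier klein3)"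
    by (subst carrier_klein3) simp
  have "card (carrier klein3) = 8"
    by (subst carrier_klein3) (simp add: card_cartesian_product)
  then show "card (cpt_word G P T C ` carrier klein3) = card (carrier klein3)"
    using assms(2) unfolding order_def assms(1) cpt_word_image by simp
qed

text \<open>The kernel is trivial, since the seven words listed are the images of the seven triples
  other than the unit. This is the criterion used for \<open>Ext p q\<close>, whose order is not
  known beforehand.\<close>

lemma cpt_word_inj_of_nontrivial:
  assumes "\<one> \<notin> {P, T, P \<otimes> T, C, C \<otimes> P, C \<otimes> T, C \<otimes> P \<otimes> T}"
  shows "inj_on (cpt_word G P T C) (carrier klein3)"
proof -
  interpret hom: group_hom klein3 G "cpt_word G P T C"
    by (intro group_hom.intro group_hom_axioms.intro group_klein3 group_axioms cpt_word_hom)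
  have "x = \<one>\<^bsub>klein3\<^esub>" if "x \<in> carrier klein3" "cpt_word G P T C x = \<one>" for x
    using that assms unfolding carrier_klein3
    by (auto simp: cpt_word_def m_assoc)
  then show ?thesis
    unfolding hom.inj_on_one_iff by blast
qed

end

lemma CPT_group_commuting_involutions:
  assumes "CPT_group G P T C"
  shows "commuting_involutions G P T C"
proof -
  interpret CPT_group G P T C by fact
  show ?thesis
    using in_carrier commuting squares by unfold_locales (simp_all add: numeral_2_eq_2)
qed

lemma CPT_group_carrier:
  assumes "CPT_group G P T C"
  shows "carrier G = {\<one>\<^bsub>G\<^esub>, P, T, P \<otimes>\<^bsub>G\<^esub> T, C, C \<otimes>\<^bsub>G\<^esub> P, C \<otimes>\<^bsub>G\<^esub> T, C \<otimes>\<^bsub>G\<^esub> P \<otimes>\<^bsub>G\<^esub> T}"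
  using CPT_group.generated[OF assms]
    commuting_involutions.generate_eq[OF CPT_group_commuting_involutions[OF assms]]
  by simp

lemma CPT_group_iso:
  assumes "CPT_group G P T C"
  shows "cpt_word G P T C \<in> iso klein3 G"
proof -
  interpret commuting_involutions G P T C
    by (rule CPT_group_commuting_involutions[OF assms])
  show ?thesis
    by (intro cpt_word_iso cpt_word_inj_of_order CPT_group_carrier CPT_group.order_8[OF assms] assms)
qed

section \<open>Diagonal maps of the Clifford algebra\<close>

lemma carrier_clifford: "x \<in> carrier (clifford n) \<longleftrightarrow> (\<forall>S. \<not> S \<subseteq> {1..n} \<longrightarrow> x S = 0)"
  and one_clifford: "\<one>\<^bsub>clifford n\<^esub> = blade {}"
  and add_clifford: "x \<oplus>\<^bsub>clifford n\<^esub> y = (\<lambda>S. x S + y S)"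
  and smult_clifford: "c \<odot>\<^bsub>clifford n\<^esub> x = (\<lambda>S. c * x S)"
  by (simp_all add: clifford_def)

lemma a_inv_clifford:
  assumes "x \<in> carrier (clifford n)"
  shows "\<ominus>\<^bsub>clifford n\<^esub> x = (\<lambda>S. - x S)"
proof -
  interpret ring "clifford n" by (rule clifford_ring)
  show ?thesis
    using assms by (intro minus_equality) (simp_all add: carrier_clifford add_clifford, simp add: clifford_def)
qed

lemma gen_carrier: "i \<in> {1..n} \<Longrightarrow> gen i \<in> carrier (clifford n)"
  by (auto simp: carrier_clifford gen_def blade_def)

lemma smult_carrier: "x \<in> carrier (clifford n) \<Longrightarrow> c \<odot>\<^bsub>clifford n\<^esub> x \<in> carrier (clifford n)"
  by (simp add: carrier_clifford smult_clifford)

lemma smult_mult_smult: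
  "(c \<odot>\<^bsub>clifford n\<^esub> x) \<otimes>\<^bsub>clifford n\<^esub> (d \<odot>\<^bsub>clifford n\<^esub> y) =
    (c * d) \<odot>\<^bsub>clifford n\<^esub> (x \<otimes>\<^bsub>clifford n\<^esub> y)"
  unfolding smult_clifford fun_eq_iff clifford_mult_apply sum_distrib_left
  by (intro allI sum.cong refl) simp

section \<open>Spanning by scaled blades, and uniqueness of semilinear homomorphisms\<close>

text \<open>Products of the scaled generators are scaled blades, and \<open>x\<close> is a
  combination of these with coefficients in \<open>R\<close>. Leaving \<open>\<omega>\<close> and
  \<open>R\<close> open serves two spans: the complex one of the whole algebra, and the real one of
  the subalgebra \<open>real_clifford p q\<close>.\<close>

lemma clifford_span:
  assumes one: "\<one>\<^bsub>clifford n\<^esub> \<in> A"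
    and gen: "\<And>i. i \<in> {1..n} \<Longrightarrow> \<omega> i \<odot>\<^bsub>clifford n\<^esub> gen i \<in> A"
    and add: "\<And>x y. x \<in> A \<Longrightarrow> y \<in> A \<Longrightarrow> x \<oplus>\<^bsub>clifford n\<^esub> y \<in> A"
    and mult: "\<And>x y. x \<in> A \<Longrightarrow> y \<in> A \<Longrightarrow> x \<otimes>\<^bsub>clifford n\<^esub> y \<in> A"
    and smult: "\<And>r x. r \<in> R \<Longrightarrow> x \<in> A \<Longrightarrow> r \<odot>\<^bsub>clifford n\<^esub> x \<in> A"
    and "0 \<in> R"
    and x: "x \<in> carrier (clifford n)"
    and coeff: "\<And>S. S \<subseteq> {1..n} \<Longrightarrow> \<exists>r\<in>R. x S = r * prod \<omega> S"
  shows "x \<in> A"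
proof -
  have blade: "prod \<omega> S \<odot>\<^bsub>clifford n\<^esub> blade S \<in> A" if "finite S" "S \<subseteq> {1..n}" for S
    using that
  proof (induction rule: finite_linorder_min_induct)
    case empty
    then show ?case using one by (simp add: one_clifford smult_clifford)
  next
    \<comment> \<open>The induction always adds a new minimum \<open>i\<close>, so multiplying by
      the generator from the left produces no reordering sign.\<close>
    case (insert i S)
    then have "prod \<omega> (insert i S) \<odot>\<^bsub>clifford n\<^esub> blade (insert i S) =
        (\<omega> i \<odot>\<^bsub>clifford n\<^esub> gen i) \<otimes>\<^bsub>clifford n\<^esub> (prod \<omega> S \<odot>\<^bsub>clifford n\<^esub> blade S)"
      by (subst clifford_blade_insert[of i n]) (auto simp: smult_mult_smult)
    then show ?case using insert gen mult by simp
  qed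
  \<comment> \<open>Now \<open>x\<close> is assembled one blade at a time; the empty sum is obtained
    as 0 times the unit.\<close>
  have "(\<lambda>S. if S \<in> F then x S else 0) \<in> A" if "finite F" "F \<subseteq> Pow {1..n}" for F
    using that
  proof (induction rule: finite_induct)
    case empty
    then show ?case using smult[OF \<open>0 \<in> R\<close> one] by (simp add: smult_clifford)
  next
    case (insert S F)
    then obtain r where r: "r \<in> R" "x S = r * prod \<omega> S"
      using coeff[of S] insert.prems by auto
    have "(\<lambda>S'. if S' \<in> insert S F then x S' else 0) =
        (r \<odot>\<^bsub>clifford n\<^esub> (prod \<omega> S \<odot>\<^bsub>clifford n\<^esub> blade S)) \<oplus>\<^bsub>clifford n\<^esub> (\<lambda>S. if S \<in> F then x S else 0)"
    proof
      fix S'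
      show "(if S' \<in> insert S F then x S' else 0) =
          ((r \<odot>\<^bsub>clifford n\<^esub> (prod \<omega> S \<odot>\<^bsub>clifford n\<^esub> blade S)) \<oplus>\<^bsub>clifford n\<^esub> (\<lambda>S. if S \<in> F then x S else 0)) S'"
        using insert.hyps(2) r(2)
        by (cases "S' = S") (simp_all add: smult_clifford add_clifford blade_def)
    qed
    moreover have "finite S" "S \<subseteq> {1..n}"
      using insert.prems finite_subset by auto
    ultimately show ?case
      using insert add smult[OF r(1)] blade by auto
  qed
  from this[of "Pow {1..n}"] have "(\<lambda>S. if S \<in> Pow {1..n} then x S else 0) \<in> A"
    by simp
  moreover have "(\<lambda>S. if S \<in> Pow {1..n} then x S else 0) = x"
    using x by (auto simp: carrier_clifford)
  ultimately show ?thesis by simp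
qed

text \<open>The set where both maps agree contains the unit and the generators and is closed under
  all operations, so it is the whole algebra. The target \<open>B\<close> is arbitrary so that
  \<open>opposite\<close> covers the antiautomorphisms too.\<close>

lemma semilinear_ring_hom_unique:
  assumes f: "f \<in> ring_hom (clifford n) B" "f \<in> semilinear_maps s (clifford n)"
    and g: "g \<in> ring_hom (clifford n) B" "g \<in> semilinear_maps s (clifford n)"
    and eq: "\<And>i. i \<in> {1..n} \<Longrightarrow> f (gen i) = g (gen i)"
  shows "f = g"
proof (rule extensionalityI)
  show "f \<in> extensional (carrier (clifford n))" "g \<in> extensional (carrier (clifford n))"
    using f g by (simp_all add: semilinear_maps_def)
next
  fix x assume x: "x \<in> carrier (clifford n)"
  interpret ring "clifford n" by (rule clifford_ring)
  have "x \<in> {x \<in> carrier (clifford n). f x = g x}"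
  proof (rule clifford_span[where R = UNIV and \<omega> = "\<lambda>_. 1"])
    fix i assume i: "i \<in> {1..n}"
    have "1 \<odot>\<^bsub>clifford n\<^esub> gen i = gen i"
      by (simp add: smult_clifford)
    then show "1 \<odot>\<^bsub>clifford n\<^esub> gen i \<in> {x \<in> carrier (clifford n). f x = g x}"
      using gen_carrier[OF i] eq[OF i] by simp
  next
    fix y z assume "y \<in> {x \<in> carrier (clifford n). f x = g x}" "z \<in> {x \<in> carrier (clifford n). f x = g x}"
    then show "y \<oplus>\<^bsub>clifford n\<^esub> z \<in> {x \<in> carrier (clifford n). f x = g x}"
      "y \<otimes>\<^bsub>clifford n\<^esub> z \<in> {x \<in> carrier (clifford n). f x = g x}"
      using f(1) g(1) by (simp_all add: ring_hom_add ring_hom_mult)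
  next
    fix r y assume "y \<in> {x \<in> carrier (clifford n). f x = g x}"
    then show "r \<odot>\<^bsub>clifford n\<^esub> y \<in> {x \<in> carrier (clifford n). f x = g x}"
      using f(2) g(2) by (simp add: smult_carrier semilinear_maps_def)
  qed (use f g x in \<open>auto simp: ring_hom_one\<close>)
  then show "f x = g x" by simp
qed

section \<open>Coordinatewise maps given by signs\<close>

definition twist ::
  "nat \<Rightarrow> (complex \<Rightarrow> complex) \<Rightarrow> (nat set \<Rightarrow> complex) \<Rightarrow> (nat set \<Rightarrow> complex) \<Rightarrow> nat set \<Rightarrow> complex" where
  "twist n s \<sigma> = (\<lambda>x\<in>carrier (clifford n). \<lambda>S. \<sigma> S * s (x S))"

lemma twist_extensional: "twist n s \<sigma> \<in> extensional (carrier (clifford n))"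
  by (simp add: twist_def)

lemma reorder_sign_square: "reorder_sign S T * reorder_sign S T = 1"
  by (auto simp: reorder_sign_def simp flip: prod.distrib intro!: prod.neutral)

lemma cnj_reorder_sign: "cnj (reorder_sign S T) = reorder_sign S T"
  by (auto simp: reorder_sign_def intro!: prod.cong)

text \<open>The values of \<open>\<sigma>\<close> are the signs 1 and -1, described by equations fit
  for rewriting: \<open>s\<close> fixes them and each is its own inverse, so the twist is an
  involution.\<close>

locale coordinate_twist =
  fixes s :: "complex \<Rightarrow> complex" and \<sigma> :: "nat set \<Rightarrow> complex"
  assumes id_or_cnj: "s = id \<or> s = cnj"
    and real_sign: "\<And>S. cnj (\<sigma> S) = \<sigma> S"
    and sign_square: "\<And>S. \<sigma> S * \<sigma> S = 1"
begin

lemma s_zero: "s 0 = 0" and s_one: "s 1 = 1" and s_sign: "s (\<sigma> S) = \<sigma> S"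
  and s_reorder_sign: "s (reorder_sign S T) = reorder_sign S T"
  and s_add: "s (a + b) = s a + s b" and s_mult: "s (a * b) = s a * s b"
  and s_s: "s (s a) = a"
  and s_sum: "s (sum f A) = sum (\<lambda>a. s (f a)) A"
  using id_or_cnj by (auto simp: real_sign cnj_reorder_sign)

lemma twist_closed: "x \<in> carrier (clifford n) \<Longrightarrow> twist n s \<sigma> x \<in> carrier (clifford n)"
  by (simp add: twist_def carrier_clifford s_zero)

lemma twist_twist:
  assumes "x \<in> carrier (clifford n)"
  shows "twist n s \<sigma> (twist n s \<sigma> x) = x"
  using assms twist_closed[OF assms]
  by (simp add: twist_def s_mult s_sign s_s sign_square flip: mult.assoc)

lemma twist_bij: "bij_betw (twist n s \<sigma>) (carrier (clifford n)) (carrier (clifford n))"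
  by (rule bij_betw_byWitness[where f' = "twist n s \<sigma>"]) (auto simp: twist_twist twist_closed)

lemma twist_Bij: "twist n s \<sigma> \<in> Bij (carrier (clifford n))"
  by (simp add: Bij_def twist_extensional twist_bij)

lemma twist_add:
  assumes "x \<in> carrier (clifford n)" "y \<in> carrier (clifford n)"
  shows "twist n s \<sigma> (x \<oplus>\<^bsub>clifford n\<^esub> y) = twist n s \<sigma> x \<oplus>\<^bsub>clifford n\<^esub> twist n s \<sigma> y"
  using assms by (simp add: twist_def carrier_clifford add_clifford s_add distrib_left)

lemma twist_smult:
  assumes "x \<in> carrier (clifford n)"
  shows "twist n s \<sigma> (c \<odot>\<^bsub>clifford n\<^esub> x) = s c \<odot>\<^bsub>clifford n\<^esub> twist n s \<sigma> x"
  using assms by (simp add: twist_def carrier_clifford smult_clifford s_mult mult_ac)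

lemma twist_semilinear: "twist n s \<sigma> \<in> semilinear_maps s (clifford n)"
  by (simp add: semilinear_maps_def twist_extensional twist_smult)

lemma twist_one:
  assumes "\<sigma> {} = 1"
  shows "twist n s \<sigma> \<one>\<^bsub>clifford n\<^esub> = \<one>\<^bsub>clifford n\<^esub>"
  using assms by (auto simp: twist_def one_clifford carrier_clifford blade_def s_zero s_one)

text \<open>Under the guard the outer sign at \<open>U\<close> is the sign at
  \<open>sym_diff S T\<close>. With it inside the double sum, products can be compared term by
  term.\<close>

lemma twist_mult_apply:
  assumes "x \<in> carrier (clifford n)" "y \<in> carrier (clifford n)"
  shows "twist n s \<sigma> (x \<otimes>\<^bsub>clifford n\<^esub> y) U = (\<Sum>S\<in>Pow {1..n}. \<Sum>T\<in>Pow {1..n}.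
    if sym_diff S T = U then \<sigma> (sym_diff S T) * reorder_sign S T * s (x S) * s (y T) else 0)"
proof -
  have "twist n s \<sigma> (x \<otimes>\<^bsub>clifford n\<^esub> y) U = \<sigma> U * s ((x \<otimes>\<^bsub>clifford n\<^esub> y) U)"
    by (simp add: twist_def clifford_mult_closed)
  also have "\<dots> = (\<Sum>S\<in>Pow {1..n}. \<Sum>T\<in>Pow {1..n}.
      \<sigma> U * s (if sym_diff S T = U then reorder_sign S T * x S * y T else 0))"
    by (simp only: clifford_mult_apply s_sum sum_distrib_left)
  also have "\<dots> = (\<Sum>S\<in>Pow {1..n}. \<Sum>T\<in>Pow {1..n}.
      if sym_diff S T = U then \<sigma> (sym_diff S T) * reorder_sign S T * s (x S) * s (y T) else 0)"
  proof (intro sum.cong refl)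
    fix S T
    show "\<sigma> U * s (if sym_diff S T = U then reorder_sign S T * x S * y T else 0) =
        (if sym_diff S T = U then \<sigma> (sym_diff S T) * reorder_sign S T * s (x S) * s (y T) else 0)"
      by (cases "sym_diff S T = U") (simp_all add: s_mult s_reorder_sign s_zero mult_ac)
  qed
  finally show ?thesis .
qed

text \<open>The hypothesis makes \<open>\<sigma>\<close> a character of the group of finite sets
  under symmetric difference, which is multiplicativity on blades.\<close>

lemma twist_automorphism:
  assumes char: "\<And>S T. finite S \<Longrightarrow> finite T \<Longrightarrow> \<sigma> (sym_diff S T) = \<sigma> S * \<sigma> T"
    and "\<sigma> {} = 1"
  shows "twist n s \<sigma> \<in> ring_iso (clifford n) (clifford n)"
proof -
  have "twist n s \<sigma> (x \<otimes>\<^bsub>clifford n\<^esub> y) = twist n s \<sigma> x \<otimes>\<^bsub>clifford n\<^esub> twist n s \<sigma> y"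
    if xy: "x \<in> carrier (clifford n)" "y \<in> carrier (clifford n)" for x y
  proof
    fix U
    show "twist n s \<sigma> (x \<otimes>\<^bsub>clifford n\<^esub> y) U = (twist n s \<sigma> x \<otimes>\<^bsub>clifford n\<^esub> twist n s \<sigma> y) U"
      unfolding twist_mult_apply[OF xy] clifford_mult_apply
    proof (intro sum.cong refl if_cong)
      fix S T assume "S \<in> Pow {1..n}" "T \<in> Pow {1..n}"
      then have "finite S" "finite T" by (auto intro: finite_subset)
      then show "\<sigma> (sym_diff S T) * reorder_sign S T * s (x S) * s (y T) =
          reorder_sign S T * twist n s \<sigma> x S * twist n s \<sigma> y T"
        using xy by (simp add: char twist_def mult_ac)
    qed
  qed
  then show ?thesis
    using twist_bij twist_closed twist_add twist_one[OF assms(2)]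
    by (auto simp: ring_iso_def intro!: ring_hom_memI)
qed

text \<open>The hypothesis is the rule f(xy) = f(y) f(x) evaluated on two blades.\<close>

lemma twist_antiautomorphism:
  assumes char: "\<And>S T. finite S \<Longrightarrow> finite T \<Longrightarrow>
      \<sigma> (sym_diff S T) * reorder_sign S T = reorder_sign T S * \<sigma> S * \<sigma> T"
    and "\<sigma> {} = 1"
  shows "twist n s \<sigma> \<in> ring_iso (clifford n) (opposite (clifford n))"
proof -
  have "twist n s \<sigma> (x \<otimes>\<^bsub>clifford n\<^esub> y) = twist n s \<sigma> y \<otimes>\<^bsub>clifford n\<^esub> twist n s \<sigma> x"
    if xy: "x \<in> carrier (clifford n)" "y \<in> carrier (clifford n)" for x y
  proof
    fix U
    show "twist n s \<sigma> (x \<otimes>\<^bsub>clifford n\<^esub> y) U = (twist n s \<sigma> y \<otimes>\<^bsub>clifford n\<^esub> twist n s \<sigma> x) U"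
      unfolding twist_mult_apply[OF xy] clifford_mult_apply
    \<comment> \<open>The factors trade places, so the two summation indices must do so as well
      before the terms match.\<close>
    proof (subst sum.swap, intro sum.cong refl if_cong)
      fix S T assume "T \<in> Pow {1..n}" "S \<in> Pow {1..n}"
      then have "finite S" "finite T" by (auto intro: finite_subset)
      then have "\<sigma> (sym_diff S T) * reorder_sign S T * s (x S) * s (y T) =
          reorder_sign T S * \<sigma> S * \<sigma> T * s (x S) * s (y T)"
        by (simp only: char)
      then show "\<sigma> (sym_diff S T) * reorder_sign S T * s (x S) * s (y T) =
          reorder_sign T S * twist n s \<sigma> y T * twist n s \<sigma> x S"
        using xy by (simp add: twist_def mult_ac)
    qed (simp add: Un_commute)
  qed
  then show ?thesis
    using twist_bij twist_closed twist_add twist_one[OF assms(2)]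
    by (auto simp: ring_iso_def opposite_def intro!: ring_hom_memI)
qed

end

text \<open>Since \<open>s\<close> fixes the real signs \<open>\<tau> S\<close>, they pass through
  it and the two signs simply multiply.\<close>

lemma compose_twist:
  assumes "coordinate_twist s \<sigma>" "coordinate_twist t \<tau>"
  shows "compose (carrier (clifford n)) (twist n s \<sigma>) (twist n t \<tau>) =
    twist n (s \<circ> t) (\<lambda>S. \<sigma> S * \<tau> S)"
proof (rule extensionalityI)
  fix x assume x: "x \<in> carrier (clifford n)"
  interpret \<sigma>: coordinate_twist s \<sigma> by fact
  interpret \<tau>: coordinate_twist t \<tau> by fact
  have "s (\<tau> S) = \<tau> S" for S
    using \<sigma>.id_or_cnj \<tau>.real_sign by auto
  then show "compose (carrier (clifford n)) (twist n s \<sigma>) (twist n t \<tau>) x =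
      twist n (s \<circ> t) (\<lambda>S. \<sigma> S * \<tau> S) x"
    using x \<tau>.twist_closed[OF x] by (simp add: compose_eq twist_def \<sigma>.s_mult mult.assoc)
qed (simp_all add: compose_extensional twist_extensional)

lemma twist_id_eq_identity:
  assumes "twist n id \<sigma> = (\<lambda>x\<in>carrier (clifford n). x)" "S \<subseteq> {1..n}"
  shows "\<sigma> S = 1"
proof -
  have "blade S \<in> carrier (clifford n)"
    using assms(2) by (auto simp: carrier_clifford blade_def)
  then show ?thesis
    using fun_cong[OF fun_cong[OF assms(1), of "blade S"], of S] by (simp add: twist_def blade_def)
qed

text \<open>Such a map sends i times the unit to -i times the unit.\<close>

lemma twist_cnj_neq_identity:
  assumes "\<sigma> {} = 1"
  shows "twist n cnj \<sigma> \<noteq> (\<lambda>x\<in>carrier (clifford n). x)"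
proof
  assume eq: "twist n cnj \<sigma> = (\<lambda>x\<in>carrier (clifford n). x)"
  have "\<i> \<odot>\<^bsub>clifford n\<^esub> blade {} \<in> carrier (clifford n)"
    by (auto simp: carrier_clifford blade_def smult_clifford)
  then show False
    using assms fun_cong[OF fun_cong[OF eq, of "\<i> \<odot>\<^bsub>clifford n\<^esub> blade {}"], of "{}"]
    by (simp add: twist_def blade_def smult_clifford)
qed

section \<open>Twists determined by signs of the generators\<close>

text \<open>Signs \<open>f i\<close> on the generators extend to an automorphism
  (\<open>direct\<close>) and to an antiautomorphism (\<open>reversing\<close>), antilinear if
  \<open>s\<close> is \<open>cnj\<close>. The eight maps arise from four choices: \<open>id\<close>
  with the constants 1 and -1, and \<open>cnj\<close> with \<open>bar_sign p\<close> and its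
  negative.\<close>

locale generator_signs =
  fixes s :: "complex \<Rightarrow> complex" and f :: "nat \<Rightarrow> complex"
  assumes s: "s = id \<or> s = cnj"
    and real: "\<And>i. cnj (f i) = f i"
    and square: "\<And>i. f i * f i = 1"
begin

sublocale direct: coordinate_twist s "prod f"
  using s by unfold_locales (simp_all add: real square flip: prod.distrib)

text \<open>reorder_sign S S has a factor -1 for each pair b < a in S, so it is the sign of reversing the
  product of the e_i with i in S.\<close>

sublocale reversing: coordinate_twist s "\<lambda>S. reorder_sign S S * prod f S"
proof
  fix S
  have "reorder_sign S S * prod f S * (reorder_sign S S * prod f S) =
      (reorder_sign S S * reorder_sign S S) * (prod f S * prod f S)"
    by (simp only: mult_ac)
  then show "reorder_sign S S * prod f S * (reorder_sign S S * prod f S) = 1"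
    by (simp only: reorder_sign_square direct.sign_square mult_1)
qed (use s in \<open>auto simp: cnj_reorder_sign real\<close>)

lemma direct_iso: "twist n s (prod f) \<in> ring_iso (clifford n) (clifford n)"
  by (rule direct.twist_automorphism) (simp_all add: prod_sym_diff square)

lemma reversing_iso:
  "twist n s (\<lambda>S. reorder_sign S S * prod f S) \<in> ring_iso (clifford n) (opposite (clifford n))"
proof (rule reversing.twist_antiautomorphism)
  fix S T :: "nat set" assume fin: "finite S" "finite T"
  \<comment> \<open>Multiplicativity in both arguments gives four factors. One of them,
    \<open>reorder_sign S T\<close>, cancels against the extra factor and leaves
    \<open>reorder_sign T S\<close>.\<close>
  then have "reorder_sign (sym_diff S T) (sym_diff S T) * reorder_sign S T =
      (reorder_sign S S * reorder_sign T S * reorder_sign T T) *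
      (reorder_sign S T * reorder_sign S T)"
    by (simp only: reorder_sign_sym_diff_left reorder_sign_sym_diff_right finite_Un finite_Diff mult_ac)
  with fin show "reorder_sign (sym_diff S T) (sym_diff S T) * prod f (sym_diff S T) * reorder_sign S T =
      reorder_sign T S * (reorder_sign S S * prod f S) * (reorder_sign T T * prod f T)"
    by (simp add: prod_sym_diff square reorder_sign_square mult_ac)
qed (simp add: reorder_sign_def)

end

lemma generator_signs_id: "generator_signs id (\<lambda>_. 1)" "generator_signs id (\<lambda>_. -1)"
  by unfold_locales simp_all

section \<open>The involution and the reversion in coordinates\<close>

text \<open>The twist shows that a map as described exists, and agreement on the generators makes it
  unique. The reversion is treated alike, with the opposite ring as target.\<close>

lemma involution_eq: "involution n = twist n id (prod (\<lambda>_. -1))"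
  unfolding involution_def
proof (rule the_equality)
  interpret generator_signs id "\<lambda>_. -1" by (rule generator_signs_id)
  let ?g = "twist n id (prod (\<lambda>_. -1))"
  have g: "?g \<in> automorphisms (clifford n)"
    by (simp add: automorphisms_def direct_iso direct.twist_semilinear)
  have gen: "?g (gen i) = \<ominus>\<^bsub>clifford n\<^esub> gen i" if "i \<in> {1..n}" for i
    using gen_carrier[OF that] by (auto simp: a_inv_clifford twist_def gen_def blade_def)
  show "?g \<in> automorphisms (clifford n) \<and> (\<forall>i\<in>{1..n}. ?g (gen i) = \<ominus>\<^bsub>clifford n\<^esub> gen i)"
    using g gen by blast
  show "h = ?g" if "h \<in> automorphisms (clifford n) \<and> (\<forall>i\<in>{1..n}. h (gen i) = \<ominus>\<^bsub>clifford n\<^esub> gen i)" for h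
    using that g gen
    by (intro semilinear_ring_hom_unique[where n = n and s = id and B = "clifford n"])
      (auto simp: automorphisms_def ring_iso_def)
qed

lemma reversion_eq: "reversion n = twist n id (\<lambda>S. reorder_sign S S)"
  unfolding reversion_def
proof (rule the_equality)
  interpret generator_signs id "\<lambda>_. 1" by (rule generator_signs_id)
  let ?g = "twist n id (\<lambda>S. reorder_sign S S)"
  have g: "?g \<in> antiautomorphisms (clifford n)"
    using reversing_iso reversing.twist_semilinear by (simp add: antiautomorphisms_def)
  have gen: "?g (gen i) = gen i" if "i \<in> {1..n}" for i
    using gen_carrier[OF that] by (auto simp: twist_def gen_def blade_def reorder_sign_def)
  show "?g \<in> antiautomorphisms (clifford n) \<and> (\<forall>i\<in>{1..n}. ?g (gen i) = gen i)"
    using g gen by blast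
  show "h = ?g" if "h \<in> antiautomorphisms (clifford n) \<and> (\<forall>i\<in>{1..n}. h (gen i) = gen i)" for h
    using that g gen
    by (intro semilinear_ring_hom_unique[where n = n and s = id and B = "opposite (clifford n)"])
      (auto simp: antiautomorphisms_def ring_iso_def)
qed

section \<open>The real subalgebra and the bar\<close>

text \<open>For i > p the bar is antilinear and fixes i times the generator, so it negates the
  generator itself; the first p generators are fixed.\<close>

definition bar_sign :: "nat \<Rightarrow> nat \<Rightarrow> complex" where
  "bar_sign p i = (if i \<le> p then 1 else -1)"

lemma generator_signs_cnj:
  "generator_signs cnj (bar_sign p)" "generator_signs cnj (\<lambda>i. - bar_sign p i)"
  by (unfold_locales; simp add: bar_sign_def)+

text \<open>The real subalgebra consists of the multivectors whose coefficient at S is a real multiple of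
  i^k, where k is the number of elements of S above p; conjugating such a coefficient multiplies it
  by (-1)^k.\<close>

lemma real_clifford_iff:
  "x \<in> real_clifford p q \<longleftrightarrow>
    x \<in> carrier (clifford (p + q)) \<and> twist (p + q) cnj (prod (bar_sign p)) x = x"
proof
  let ?A = "clifford (p + q)" and ?b = "twist (p + q) cnj (prod (bar_sign p))"
  interpret generator_signs cnj "bar_sign p" by (rule generator_signs_cnj)
  interpret ring ?A by (rule clifford_ring)
  have hom: "?b \<in> ring_hom ?A ?A"
    using direct_iso by (simp add: ring_iso_def)
  have gen: "?b (c \<odot>\<^bsub>?A\<^esub> gen i) = (bar_sign p i * cnj c) \<odot>\<^bsub>?A\<^esub> gen i" if "i \<in> {1..p+q}" for c i
    using smult_carrier[OF gen_carrier[OF that]]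
    by (auto simp: twist_def smult_clifford gen_def blade_def)
  show "x \<in> carrier ?A \<and> ?b x = x" if "x \<in> real_clifford p q"
    using that
  proof induction
    case one
    then show ?case using ring_hom_one[OF hom] by simp
  next
    case (gen_pos i)
    then have "bar_sign p i = 1" by (simp add: bar_sign_def)
    with gen_pos show ?case
      using gen[of i 1] gen_carrier[of i "p + q"] by (simp add: smult_clifford)
  next
    case (gen_neg i)
    then have "bar_sign p i = -1" by (simp add: bar_sign_def)
    with gen_neg show ?case
      using gen[of i \<i>] gen_carrier[of i "p + q"] by (simp add: smult_carrier)
  next
    case (smult x r)
    then show ?case by (simp add: smult_carrier direct.twist_smult)
  next
    case (add x y)
    then show ?case by (simp add: direct.twist_add)
  next
    case (mult x y)
    then show ?case using ring_hom_mult[OF hom] by simp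
  qed
  show "x \<in> real_clifford p q" if "x \<in> carrier ?A \<and> ?b x = x"
  proof -
    from that have x: "x \<in> carrier ?A" and fixed: "?b x = x" by auto
    \<comment> \<open>These are the phases that turn the orthobasis into the generators of the real
      subalgebra.\<close>
    let ?\<omega> = "\<lambda>i. if i \<le> p then 1 else \<i>"
    show ?thesis
    proof (rule clifford_span[where n = "p + q" and \<omega> = ?\<omega> and R = "\<real>"])
      fix i assume i: "i \<in> {1..p+q}"
      have "1 \<odot>\<^bsub>?A\<^esub> gen i = gen i" by (simp add: smult_clifford)
      then show "?\<omega> i \<odot>\<^bsub>?A\<^esub> gen i \<in> real_clifford p q"
        using i real_clifford.gen_pos[of i p q] real_clifford.gen_neg[of i p q] by auto
    next
      fix r :: complex and x assume "r \<in> \<real>" "x \<in> real_clifford p q"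
      then show "r \<odot>\<^bsub>?A\<^esub> x \<in> real_clifford p q"
        by (auto elim!: Reals_cases intro: real_clifford.smult)
    next
      fix S :: "nat set"
      \<comment> \<open>This is the quotient of \<open>x S\<close> by the phase of the blade,
        because a phase has its conjugate as inverse. It remains to see that it is real.\<close>
      let ?r = "x S * cnj (prod ?\<omega> S)"
      have unit: "cnj (prod ?\<omega> S) * prod ?\<omega> S = 1"
        unfolding cnj_prod prod.distrib[symmetric] by (intro prod.neutral) simp
      \<comment> \<open>The bar sign is the square of the phase.\<close>
      have phase: "prod (bar_sign p) S * cnj (prod ?\<omega> S) = prod ?\<omega> S"
        unfolding cnj_prod prod.distrib[symmetric] by (intro prod.cong) (simp_all add: bar_sign_def)
      have "?r = prod (bar_sign p) S * cnj (x S) * cnj (prod ?\<omega> S)"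
        using fun_cong[OF fixed, of S] x by (simp add: twist_def)
      also have "\<dots> = cnj (x S) * prod ?\<omega> S"
        by (subst (2) phase[symmetric]) (simp only: mult_ac)
      finally have "cnj ?r = ?r" by simp
      then have "?r \<in> \<real>" by (simp only: Reals_cnj_iff)
      moreover have "x S = ?r * prod ?\<omega> S"
        by (simp only: mult.assoc unit mult_1_right)
      ultimately show "\<exists>r\<in>\<real>. x S = r * prod ?\<omega> S" by blast
    qed (use x in \<open>auto intro: real_clifford.intros\<close>)
  qed
qed

text \<open>The twist is an antilinear involution with fixed set \<open>real_clifford p q\<close>,
  so it acts as complex conjugation with respect to that real form.\<close>

lemma bar_eq: "bar p q = twist (p + q) cnj (prod (bar_sign p))"
proof (rule extensionalityI)
  let ?A = "clifford (p + q)" and ?b = "twist (p + q) cnj (prod (bar_sign p))"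
  interpret generator_signs cnj "bar_sign p" by (rule generator_signs_cnj)
  interpret ring ?A by (rule clifford_ring)
  show "bar p q \<in> extensional (carrier ?A)" by (simp add: bar_def)
  show "?b \<in> extensional (carrier ?A)" by (rule twist_extensional)
  fix x assume x: "x \<in> carrier ?A"
  \<comment> \<open>Every decomposition of \<open>x\<close> therefore yields the same value, which
    settles uniqueness for the \<open>THE\<close>.\<close>
  have b_minus: "x1 \<ominus>\<^bsub>?A\<^esub> (\<i> \<odot>\<^bsub>?A\<^esub> x2) = ?b (x1 \<oplus>\<^bsub>?A\<^esub> (\<i> \<odot>\<^bsub>?A\<^esub> x2))"
    if "x1 \<in> real_clifford p q" "x2 \<in> real_clifford p q" for x1 x2
  proof -
    from that have "?b x1 = x1" "?b x2 = x2" and car: "x1 \<in> carrier ?A" "x2 \<in> carrier ?A"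
      by (simp_all add: real_clifford_iff)
    then have "?b (x1 \<oplus>\<^bsub>?A\<^esub> (\<i> \<odot>\<^bsub>?A\<^esub> x2)) = x1 \<oplus>\<^bsub>?A\<^esub> (cnj \<i> \<odot>\<^bsub>?A\<^esub> x2)"
      by (simp add: direct.twist_add direct.twist_smult smult_carrier)
    also have "\<dots> = x1 \<ominus>\<^bsub>?A\<^esub> (\<i> \<odot>\<^bsub>?A\<^esub> x2)"
      using car by (simp add: a_minus_def a_inv_clifford smult_carrier) (simp add: smult_clifford)
    finally show ?thesis ..
  qed
  \<comment> \<open>For existence: the real and imaginary parts of \<open>x\<close> relative to the
    antilinear involution.\<close>
  define x1 where "x1 = (1/2) \<odot>\<^bsub>?A\<^esub> (x \<oplus>\<^bsub>?A\<^esub> ?b x)"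
  define x2 where "x2 = (- \<i>/2) \<odot>\<^bsub>?A\<^esub> (x \<oplus>\<^bsub>?A\<^esub> ((-1) \<odot>\<^bsub>?A\<^esub> ?b x))"
  have bx: "?b x \<in> carrier ?A" using x by (rule direct.twist_closed)
  have "?b x1 = x1"
    using x bx by (simp add: x1_def direct.twist_add direct.twist_smult direct.twist_twist a_comm)
  then have x1: "x1 \<in> real_clifford p q"
    using x bx by (simp add: real_clifford_iff x1_def smult_carrier)
  have "?b x2 = (\<i>/2) \<odot>\<^bsub>?A\<^esub> (?b x \<oplus>\<^bsub>?A\<^esub> ((-1) \<odot>\<^bsub>?A\<^esub> x))"
    using x bx by (simp add: x2_def direct.twist_add direct.twist_smult direct.twist_twist smult_carrier)
  also have "\<dots> = x2"
    by (simp add: x2_def smult_clifford add_clifford algebra_simps)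
  finally have x2: "x2 \<in> real_clifford p q"
    using x bx by (simp add: real_clifford_iff x2_def smult_carrier)
  have x_eq: "x = x1 \<oplus>\<^bsub>?A\<^esub> (\<i> \<odot>\<^bsub>?A\<^esub> x2)"
    by (simp add: x1_def x2_def smult_clifford add_clifford algebra_simps)
  have "(THE y. \<exists>x1\<in>real_clifford p q. \<exists>x2\<in>real_clifford p q.
      x = x1 \<oplus>\<^bsub>?A\<^esub> (\<i> \<odot>\<^bsub>?A\<^esub> x2) \<and> y = x1 \<ominus>\<^bsub>?A\<^esub> (\<i> \<odot>\<^bsub>?A\<^esub> x2)) = ?b x"
  proof (rule the_equality)
    show "\<exists>x1\<in>real_clifford p q. \<exists>x2\<in>real_clifford p q.
      x = x1 \<oplus>\<^bsub>?A\<^esub> (\<i> \<odot>\<^bsub>?A\<^esub> x2) \<and> ?b x = x1 \<ominus>\<^bsub>?A\<^esub> (\<i> \<odot>\<^bsub>?A\<^esub> x2)"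
      using x1 x2 x_eq b_minus[OF x1 x2] by metis
  qed (use b_minus in metis)
  then show "bar p q x = ?b x" using x by (simp add: bar_def)
qed

section \<open>The composite maps in coordinates\<close>

lemma conjugation_eq:
  "conjugation n = twist n id (\<lambda>S. reorder_sign S S * prod (\<lambda>_. -1) S)"
proof -
  interpret one: generator_signs id "\<lambda>_. 1" by (rule generator_signs_id)
  interpret neg: generator_signs id "\<lambda>_. -1" by (rule generator_signs_id)
  show ?thesis
    using compose_twist[OF one.reversing.coordinate_twist_axioms neg.direct.coordinate_twist_axioms]
    by (simp add: conjugation_def involution_eq reversion_eq)
qed

text \<open>This merges the sign of the involution into \<open>bar_sign\<close>, so that its
  composites with the bar are again of the form treated in \<open>generator_signs\<close>.\<close>

lemma prod_uminus: "(\<Prod>i\<in>S. - f i) = prod f S * (\<Prod>_\<in>S. - 1)" for f :: "nat \<Rightarrow> complex"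
  unfolding prod.distrib[symmetric] by simp

lemma bar_involution_eq:
  "bar_involution p q = twist (p + q) cnj (prod (\<lambda>i. - bar_sign p i))"
proof -
  interpret neg: generator_signs id "\<lambda>_. -1" by (rule generator_signs_id)
  interpret bar: generator_signs cnj "bar_sign p" by (rule generator_signs_cnj)
  have "prod (\<lambda>i. - bar_sign p i) = (\<lambda>S. prod (bar_sign p) S * (\<Prod>_\<in>S. - 1))"
    by (rule ext) (rule prod_uminus)
  then show ?thesis
    using compose_twist[OF bar.direct.coordinate_twist_axioms neg.direct.coordinate_twist_axioms]
    by (simp only: bar_involution_def involution_eq bar_eq o_id)
qed

lemma bar_reversion_eq:
  "bar_reversion p q = twist (p + q) cnj (\<lambda>S. reorder_sign S S * prod (bar_sign p) S)"
proof -
  interpret one: generator_signs id "\<lambda>_. 1" by (rule generator_signs_id)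
  interpret bar: generator_signs cnj "bar_sign p" by (rule generator_signs_cnj)
  show ?thesis
    using compose_twist[OF bar.direct.coordinate_twist_axioms one.reversing.coordinate_twist_axioms]
    by (simp add: bar_reversion_def reversion_eq bar_eq mult.commute)
qed

lemma bar_conjugation_eq:
  "bar_conjugation p q = twist (p + q) cnj (\<lambda>S. reorder_sign S S * prod (\<lambda>i. - bar_sign p i) S)"
proof -
  interpret neg: generator_signs id "\<lambda>_. -1" by (rule generator_signs_id)
  interpret bar: generator_signs cnj "bar_sign p" by (rule generator_signs_cnj)
  have "prod (bar_sign p) S * (reorder_sign S S * prod (\<lambda>_. -1) S) =
      reorder_sign S S * prod (\<lambda>i. - bar_sign p i) S" for S
    by (simp only: prod_uminus[of "bar_sign p"] mult_ac)
  then show ?thesis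
    using compose_twist[OF bar.direct.coordinate_twist_axioms neg.reversing.coordinate_twist_axioms]
    by (simp only: bar_conjugation_def conjugation_eq bar_eq o_id)
qed

section \<open>The kind of each of the seven maps\<close>

lemma involution_automorphism: "involution n \<in> automorphisms (clifford n)"
proof -
  interpret generator_signs id "\<lambda>_. -1" by (rule generator_signs_id)
  show ?thesis
    by (simp add: automorphisms_def involution_eq direct_iso direct.twist_semilinear)
qed

lemma reversion_antiautomorphism: "reversion n \<in> antiautomorphisms (clifford n)"
proof -
  interpret generator_signs id "\<lambda>_. 1" by (rule generator_signs_id)
  show ?thesis
    using reversing_iso reversing.twist_semilinear by (simp add: antiautomorphisms_def reversion_eq)
qed

lemma conjugation_antiautomorphism: "conjugation n \<in> antiautomorphisms (clifford n)"
proof -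
  interpret generator_signs id "\<lambda>_. -1" by (rule generator_signs_id)
  show ?thesis
    by (simp only: antiautomorphisms_def conjugation_eq Int_iff reversing_iso reversing.twist_semilinear)
qed

lemma bar_pseudoautomorphism: "bar p q \<in> pseudoautomorphisms (clifford (p + q))"
proof -
  interpret generator_signs cnj "bar_sign p" by (rule generator_signs_cnj)
  show ?thesis
    by (simp add: pseudoautomorphisms_def bar_eq direct_iso direct.twist_semilinear)
qed

lemma bar_involution_pseudoautomorphism:
  "bar_involution p q \<in> pseudoautomorphisms (clifford (p + q))"
proof -
  interpret generator_signs cnj "\<lambda>i. - bar_sign p i" by (rule generator_signs_cnj)
  show ?thesis
    by (simp only: pseudoautomorphisms_def bar_involution_eq Int_iff direct_iso direct.twist_semilinear)
qed

lemma bar_reversion_pseudoantiautomorphism: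
  "bar_reversion p q \<in> pseudoantiautomorphisms (clifford (p + q))"
proof -
  interpret generator_signs cnj "bar_sign p" by (rule generator_signs_cnj)
  show ?thesis
    by (simp add: pseudoantiautomorphisms_def bar_reversion_eq reversing_iso reversing.twist_semilinear)
qed

lemma bar_conjugation_pseudoantiautomorphism:
  "bar_conjugation p q \<in> pseudoantiautomorphisms (clifford (p + q))"
proof -
  interpret generator_signs cnj "\<lambda>i. - bar_sign p i" by (rule generator_signs_cnj)
  show ?thesis
    by (simp only: pseudoantiautomorphisms_def bar_conjugation_eq Int_iff reversing_iso
        reversing.twist_semilinear)
qed

section \<open>The extended automorphism group\<close>

lemma mult_BijGroup:
  "f \<in> Bij A \<Longrightarrow> g \<in> Bij A \<Longrightarrow> f \<otimes>\<^bsub>BijGroup A\<^esub> g = compose A f g"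
  by (simp add: BijGroup_def)

lemma (in coordinate_twist) twist_BijGroup_square:
  "twist n s \<sigma> \<otimes>\<^bsub>BijGroup (carrier (clifford n))\<^esub> twist n s \<sigma> = \<one>\<^bsub>BijGroup (carrier (clifford n))\<^esub>"
  using twist_twist
  by (simp add: mult_BijGroup twist_Bij compose_def) (simp add: BijGroup_def restrict_def fun_eq_iff)

lemma twist_BijGroup_commute:
  assumes "coordinate_twist s \<sigma>" "coordinate_twist t \<tau>"
  shows "twist n s \<sigma> \<otimes>\<^bsub>BijGroup (carrier (clifford n))\<^esub> twist n t \<tau> =
    twist n t \<tau> \<otimes>\<^bsub>BijGroup (carrier (clifford n))\<^esub> twist n s \<sigma>"
proof -
  interpret \<sigma>: coordinate_twist s \<sigma> by fact
  interpret \<tau>: coordinate_twist t \<tau> by fact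
  have "s \<circ> t = t \<circ> s"
    using \<sigma>.id_or_cnj \<tau>.id_or_cnj by auto
  then show ?thesis
    by (simp add: mult_BijGroup \<sigma>.twist_Bij \<tau>.twist_Bij compose_twist assms mult.commute)
qed

text \<open>The relations are checked first in the group of all bijections of the algebra;
  \<open>Ext p q\<close> is recognized as a subgroup of it afterwards.\<close>

lemma commuting_involutions_BijGroup:
  "commuting_involutions (BijGroup (carrier (clifford (p + q))))
    (involution (p + q)) (reversion (p + q)) (bar p q)"
proof -
  interpret one: generator_signs id "\<lambda>_. 1" by (rule generator_signs_id)
  interpret neg: generator_signs id "\<lambda>_. -1" by (rule generator_signs_id)
  interpret bar: generator_signs cnj "bar_sign p" by (rule generator_signs_cnj)
  interpret rev: coordinate_twist id "\<lambda>S. reorder_sign S S"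
    using one.reversing.coordinate_twist_axioms by simp
  show ?thesis
    unfolding involution_eq reversion_eq bar_eq
  proof (intro commuting_involutions.intro commuting_involutions_axioms.intro group_BijGroup)
  qed (simp_all only: twist_BijGroup_commute neg.direct.coordinate_twist_axioms
      rev.coordinate_twist_axioms bar.direct.coordinate_twist_axioms neg.direct.twist_BijGroup_square
      rev.twist_BijGroup_square bar.direct.twist_BijGroup_square, simp_all add: BijGroup_def
      neg.direct.twist_Bij rev.twist_Bij bar.direct.twist_Bij)
qed

text \<open>The eight maps are exactly the eight words in three commuting involutions, so they form
  a generated subgroup. This is what makes \<open>Ext p q\<close> a group.\<close>

lemma carrier_Ext:
  "carrier (Ext p q) = generate (BijGroup (carrier (clifford (p + q))))
    {involution (p + q), reversion (p + q), bar p q}"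
proof -
  let ?B = "BijGroup (carrier (clifford (p + q)))"
  interpret commuting_involutions ?B "involution (p + q)" "reversion (p + q)" "bar p q"
    by (rule commuting_involutions_BijGroup)
  have compose: "compose (carrier (clifford (p + q))) f g = f \<otimes>\<^bsub>?B\<^esub> g"
    if "f \<in> carrier ?B" "g \<in> carrier ?B" for f g
    using that mult_BijGroup by (simp add: BijGroup_def)
  \<comment> \<open>By definition the involution is applied first; commutativity restores the order
    P T.\<close>
  have "conjugation (p + q) = involution (p + q) \<otimes>\<^bsub>?B\<^esub> reversion (p + q)"
    by (simp add: conjugation_def compose comm)
  moreover from this have "bar_conjugation p q = bar p q \<otimes>\<^bsub>?B\<^esub> involution (p + q) \<otimes>\<^bsub>?B\<^esub> reversion (p + q)"
    by (simp add: bar_conjugation_def compose m_assoc)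
  moreover have "\<one>\<^bsub>?B\<^esub> = (\<lambda>x\<in>carrier (clifford (p + q)). x)"
    by (simp add: BijGroup_def)
  ultimately show ?thesis
    unfolding generate_eq by (simp add: Ext_def bar_involution_def bar_reversion_def compose)
qed

lemma commuting_involutions_Ext:
  "commuting_involutions (Ext p q) (involution (p + q)) (reversion (p + q)) (bar p q)"
proof -
  let ?B = "BijGroup (carrier (clifford (p + q)))"
  let ?H = "generate ?B {involution (p + q), reversion (p + q), bar p q}"
  interpret commuting_involutions ?B "involution (p + q)" "reversion (p + q)" "bar p q"
    by (rule commuting_involutions_BijGroup)
  have Ext: "Ext p q = ?B\<lparr>carrier := ?H\<rparr>"
    using carrier_Ext[of p q] by (simp add: Ext_def)
  have "subgroup ?H ?B"
    by (rule generate_is_subgroup) simp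
  then have "group (Ext p q)"
    unfolding Ext by (rule subgroup.subgroup_is_group) (rule group_axioms)
  then show ?thesis
    by (rule commuting_involutions.intro, unfold_locales)
      (simp_all add: Ext comm square generate.incl)
qed

text \<open>The dictionary for PT, CP, CT and CPT. The last product appears in both bracketings: C
  (PT) as in \<open>cpt_word\<close>, and (CP) T as in the list of the carrier.\<close>

lemma Ext_products:
  "involution (p + q) \<otimes>\<^bsub>Ext p q\<^esub> reversion (p + q) = conjugation (p + q)"
  "bar p q \<otimes>\<^bsub>Ext p q\<^esub> involution (p + q) = bar_involution p q"
  "bar p q \<otimes>\<^bsub>Ext p q\<^esub> reversion (p + q) = bar_reversion p q"
  "bar p q \<otimes>\<^bsub>Ext p q\<^esub> conjugation (p + q) = bar_conjugation p q"
  "bar_involution p q \<otimes>\<^bsub>Ext p q\<^esub> reversion (p + q) = bar_conjugation p q"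
proof -
  let ?B = "BijGroup (carrier (clifford (p + q)))"
  interpret commuting_involutions "Ext p q" "involution (p + q)" "reversion (p + q)" "bar p q"
    by (rule commuting_involutions_Ext)
  have "{involution (p + q), reversion (p + q), bar p q} \<subseteq> carrier ?B"
    using commuting_involutions.closed[OF commuting_involutions_BijGroup] by blast
  then have "carrier (Ext p q) \<subseteq> carrier ?B"
    unfolding carrier_Ext by (rule group.generate_incl[OF group_BijGroup])
  then have Bij: "f \<in> Bij (carrier (clifford (p + q)))" if "f \<in> carrier (Ext p q)" for f
    using that unfolding BijGroup_def by auto
  have compose: "compose (carrier (clifford (p + q))) f g = f \<otimes>\<^bsub>Ext p q\<^esub> g"
    if "f \<in> carrier (Ext p q)" "g \<in> carrier (Ext p q)" for f g
    using mult_BijGroup[OF Bij[OF that(1)] Bij[OF that(2)]] by (simp add: Ext_def)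
  have conj: "conjugation (p + q) = involution (p + q) \<otimes>\<^bsub>Ext p q\<^esub> reversion (p + q)"
    by (simp add: conjugation_def compose comm)
  show "involution (p + q) \<otimes>\<^bsub>Ext p q\<^esub> reversion (p + q) = conjugation (p + q)"
    "bar p q \<otimes>\<^bsub>Ext p q\<^esub> involution (p + q) = bar_involution p q"
    "bar p q \<otimes>\<^bsub>Ext p q\<^esub> reversion (p + q) = bar_reversion p q"
    "bar p q \<otimes>\<^bsub>Ext p q\<^esub> conjugation (p + q) = bar_conjugation p q"
    "bar_involution p q \<otimes>\<^bsub>Ext p q\<^esub> reversion (p + q) = bar_conjugation p q"
    by (simp_all add: conj bar_involution_def bar_reversion_def bar_conjugation_def compose m_assoc)
qed

lemma cpt_word_Ext_iso:
  assumes "2 \<le> p + q"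
  shows "cpt_word (Ext p q) (involution (p + q)) (reversion (p + q)) (bar p q) \<in> iso klein3 (Ext p q)"
proof -
  interpret commuting_involutions "Ext p q" "involution (p + q)" "reversion (p + q)" "bar p q"
    by (rule commuting_involutions_Ext)
  have one: "\<one>\<^bsub>Ext p q\<^esub> = (\<lambda>x\<in>carrier (clifford (p + q)). x)"
    by (simp add: Ext_def BijGroup_def)
  \<comment> \<open>Here two generators must exist: the reversion is seen to be nontrivial on their
    product. For the involution and the conjugation the first generator suffices.\<close>
  have "reorder_sign {1, 2} {1, 2} = -1"
    by (simp add: reorder_sign_def)
  then have "reversion (p + q) \<noteq> \<one>\<^bsub>Ext p q\<^esub>"
    using assms twist_id_eq_identity[of "p + q" "\<lambda>S. reorder_sign S S" "{1, 2}"]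
    by (auto simp: reversion_eq one)
  moreover have "involution (p + q) \<noteq> \<one>\<^bsub>Ext p q\<^esub>"
    using assms twist_id_eq_identity[of "p + q" "prod (\<lambda>_. -1)" "{1}"]
    by (auto simp: involution_eq one)
  moreover have "conjugation (p + q) \<noteq> \<one>\<^bsub>Ext p q\<^esub>"
    using assms twist_id_eq_identity[of "p + q" "\<lambda>S. reorder_sign S S * prod (\<lambda>_. -1) S" "{1}"]
    by (auto simp: conjugation_eq one reorder_sign_def)
  \<comment> \<open>These four are antilinear and fix the unit.\<close>
  moreover have "\<one>\<^bsub>Ext p q\<^esub> \<notin> {bar p q, bar_involution p q, bar_reversion p q, bar_conjugation p q}"
    by (simp add: one bar_eq bar_involution_eq bar_reversion_eq bar_conjugation_eq
        reorder_sign_def twist_cnj_neq_identity[symmetric])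
  ultimately have "inj_on (cpt_word (Ext p q) (involution (p + q)) (reversion (p + q)) (bar p q))
      (carrier klein3)"
    by (intro cpt_word_inj_of_nontrivial) (auto simp: Ext_products)
  moreover have "carrier (Ext p q) = {\<one>\<^bsub>Ext p q\<^esub>, involution (p + q), reversion (p + q),
      conjugation (p + q), bar p q, bar_involution p q, bar_reversion p q, bar_conjugation p q}"
    by (simp add: Ext_def BijGroup_def)
  ultimately show ?thesis
    by (intro cpt_word_iso) (simp_all add: Ext_products)
qed

theorem proposition2:
  fixes p q :: nat and G :: "('g, 'm) monoid_scheme" and P T C :: 'g
  assumes "2 \<le> p + q"
    and "CPT_group G P T C"
  shows "group (Ext p q) \<and>
    carrier G = {\<one>\<^bsub>G\<^esub>, P, T, P \<otimes>\<^bsub>G\<^esub> T, C, C \<otimes>\<^bsub>G\<^esub> P, C \<otimes>\<^bsub>G\<^esub> T, C \<otimes>\<^bsub>G\<^esub> P \<otimes>\<^bsub>G\<^esub> T} \<and>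
    (\<exists>\<phi>\<in>iso (Ext p q) G.
       \<phi> (involution (p + q)) = P \<and>
       \<phi> (reversion (p + q)) = T \<and>
       \<phi> (conjugation (p + q)) = P \<otimes>\<^bsub>G\<^esub> T \<and>
       \<phi> (bar p q) = C \<and>
       \<phi> (bar_involution p q) = C \<otimes>\<^bsub>G\<^esub> P \<and>
       \<phi> (bar_reversion p q) = C \<otimes>\<^bsub>G\<^esub> T \<and>
       \<phi> (bar_conjugation p q) = C \<otimes>\<^bsub>G\<^esub> P \<otimes>\<^bsub>G\<^esub> T) \<and>
    G \<cong> integer_mod_group 2 \<times>\<times> integer_mod_group 2 \<times>\<times> integer_mod_group 2 \<and>
    involution (p + q) \<in> automorphisms (clifford (p + q)) \<and>
    reversion (p + q) \<in> antiautomorphisms (clifford (p + q)) \<and>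
    conjugation (p + q) \<in> antiautomorphisms (clifford (p + q)) \<and>
    bar p q \<in> pseudoautomorphisms (clifford (p + q)) \<and>
    bar_involution p q \<in> pseudoautomorphisms (clifford (p + q)) \<and>
    bar_reversion p q \<in> pseudoantiautomorphisms (clifford (p + q)) \<and>
    bar_conjugation p q \<in> pseudoantiautomorphisms (clifford (p + q))"
proof -
  let ?w = "cpt_word (Ext p q) (involution (p + q)) (reversion (p + q)) (bar p q)"
  interpret G: commuting_involutions G P T C
    by (rule CPT_group_commuting_involutions[OF assms(2)])
  interpret E: commuting_involutions "Ext p q" "involution (p + q)" "reversion (p + q)" "bar p q"
    by (rule commuting_involutions_Ext)
  have w: "?w \<in> iso klein3 (Ext p q)"
    by (rule cpt_word_Ext_iso[OF assms(1)])
  have g: "cpt_word G P T C \<in> iso klein3 G"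
    by (rule CPT_group_iso[OF assms(2)])
  obtain \<phi> where \<phi>: "\<phi> \<in> iso (Ext p q) G"
    and \<phi>_w: "\<And>k. k \<in> {0, 1} \<times> {0, 1} \<times> {0, 1} \<Longrightarrow> \<phi> (?w k) = cpt_word G P T C k"
  proof
    \<comment> \<open>A map in \<open>Ext p q\<close> is read as its triple of exponents, which is
      then spelled out in \<open>G\<close>.\<close>
    let ?\<phi> = "cpt_word G P T C \<circ> inv_into (carrier klein3) ?w"
    show "?\<phi> \<in> iso (Ext p q) G"
      by (rule iso_set_trans[OF group.iso_set_sym[OF group_klein3 w] g])
    show "?\<phi> (?w k) = cpt_word G P T C k" if "k \<in> {0, 1} \<times> {0, 1} \<times> {0, 1}" for k
      using w that unfolding carrier_klein3[symmetric] by (simp add: iso_def bij_betw_def)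
  qed
  \<comment> \<open>The seven nonzero triples give the seven correspondences.\<close>
  from \<phi>_w[of "(1, 0, 0)"] \<phi>_w[of "(0, 1, 0)"] \<phi>_w[of "(1, 1, 0)"] \<phi>_w[of "(0, 0, 1)"]
    \<phi>_w[of "(1, 0, 1)"] \<phi>_w[of "(0, 1, 1)"] \<phi>_w[of "(1, 1, 1)"]
  have "\<phi> (involution (p + q)) = P \<and>
       \<phi> (reversion (p + q)) = T \<and>
       \<phi> (conjugation (p + q)) = P \<otimes>\<^bsub>G\<^esub> T \<and>
       \<phi> (bar p q) = C \<and>
       \<phi> (bar_involution p q) = C \<otimes>\<^bsub>G\<^esub> P \<and>
       \<phi> (bar_reversion p q) = C \<otimes>\<^bsub>G\<^esub> T \<and>
       \<phi> (bar_conjugation p q) = C \<otimes>\<^bsub>G\<^esub> P \<otimes>\<^bsub>G\<^esub> T"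
    using E.m_closed[OF E.closed(1,2)]
    by (simp add: cpt_word_def Ext_products flip: G.m_assoc)
  with \<phi> show ?thesis
    using E.is_group CPT_group_carrier[OF assms(2)] group.iso_sym[OF group_klein3 is_isoI[OF g]]
      involution_automorphism reversion_antiautomorphism conjugation_antiautomorphism
      bar_pseudoautomorphism bar_involution_pseudoautomorphism
      bar_reversion_pseudoantiautomorphism bar_conjugation_pseudoantiautomorphism
    by blast
qed

end
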